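(* Let $G$ be the graph on the $7$ vertices $1,\dots,7$ with edges $\{1,2\}$, $\{1,3\}$, $\{2,3\}$, $\{2,4\}$, $\{3,4\}$, $\{4,5\}$, $\{4,6\}$, $\{4,7\}$, $\{5,6\}$, $\{5,7\}$, $\{3,6\}$, $\{3,7\}$. Put $n'=7$. Then there exists a Jordan chain $(\lambda,\mathbf{v},\mathbf{u})$ for $K(G)$ with $\lambda=\frac{-1-\sqrt7\,i}{2}$ and with $\mathbf{v},\mathbf{u}\in\mathbb{C}^{14}$ given by $$\mathbf{v}_j=\begin{cases}\lambda&j=1\\2/\lambda&j=2\\0&j=3\\1&j=4\\-1&j=5\\0&\text{else}\end{cases}\qquad \mathbf{v}_{n'+j}=\begin{cases}-1&j=1\\-2/\lambda^2&j=2\\0&j=3\\-1/\lambda&j=4\\1/\lambda&j=5\\0&\text{else}\end{cases}$$ $$\mathbf{u}_j=\begin{cases}1&j=1\\(5\lambda-3)/2&j=2\\(3-\lambda)/2&j=3\\-7(\lambda+1)/2&j=4\\4\lambda+2&j=5\\0&\text{else}\end{cases}\qquad \mathbf{u}_{n'+j}=\begin{cases}0&j=1\\-(\lambda+5)/2&j=2\\(3\lambda+5)/4&j=3\\3(1-\lambda)/2&j=4\\(3\lambda-11)/4&j=5\\0&\text{else}\end{cases}$$ for $1\le j\le 7$.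
   Context: For a simple graph $G$ on vertices $1,\dots,n'$ with adjacency matrix $A$ and diagonal degree matrix $D$, $K(G)=\begin{bmatrix} A & D-I_{n'}\\ -I_{n'} & 0\end{bmatrix}$. Jordan chain: let $(\lambda,\mathbf{u}^{(1)})$ be an eigenpair for a matrix $N$, let $\mathbf{u}^{(0)}$ be the zero vector, and let $k$ be the largest integer such that the system $(N-\lambda I)\mathbf{u}^{(j+1)}=\mathbf{u}^{(j)}$ has a solution for all $j\in\{0,1,\dots,k-1\}$. The sequence $\mathbf{u}^{(1)},\dots,\mathbf{u}^{(k)}$ is a Jordan chain of length $k$ of $N$ for $\lambda$. "$(\lambda,\mathbf{v},\mathbf{u})$ is a Jordan chain for $K(G)$" means that $\mathbf{u}^{(1)}=\mathbf{v}$, $\mathbf{u}^{(2)}=\mathbf{u}$ is a Jordan chain (of length $2$) of $K(G)$ for the eigenvalue $\lambda$; in particular $\mathbf{v}\ne 0$, $K(G)\mathbf{v}=\lambda\mathbf{v}$ and $K(G)\mathbf{u}=\lambda\mathbf{u}+\mathbf{v}$. *)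

theory Defs
  imports Complex_Main "Jordan_Normal_Form.Char_Poly"
begin

text \<open>
  A graph on the vertices \<open>1, \<dots>, n\<close> is given by \<open>n\<close> and its set of edges, each edge being the
  two-element set of its ends. Vectors and matrices are indexed from 0, so vertex \<open>i + 1\<close> belongs
  to row and column \<open>i\<close>.
\<close>

definition simple_graph :: "nat \<Rightarrow> nat set set \<Rightarrow> bool" where
  "simple_graph n E \<longleftrightarrow> (\<forall>e\<in>E. e \<subseteq> {1..n} \<and> card e = 2)"

definition adjacency_mat :: "nat \<Rightarrow> nat set set \<Rightarrow> complex mat" where
  "adjacency_mat n E = mat n n (\<lambda>(i, j). if {i + 1, j + 1} \<in> E then 1 else 0)"

definition degree_mat :: "nat \<Rightarrow> nat set set \<Rightarrow> complex mat" where
  "degree_mat n E = mat n n (\<lambda>(i, j). if i = j then of_nat (card {e \<in> E. i + 1 \<in> e}) else 0)"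

definition K_mat :: "nat \<Rightarrow> nat set set \<Rightarrow> complex mat" where
  "K_mat n E = four_block_mat
     (adjacency_mat n E) (degree_mat n E - 1\<^sub>m n)
     (- 1\<^sub>m n)           (0\<^sub>m n n)"

text \<open>
  The list \<open>us\<close> holds the vectors with indices \<open>1, \<dots>, k\<close>; \<open>0\<^sub>v n # us\<close> puts the zero vector in front
  as the one with index 0.
\<close>

definition solves_jordan_system :: "'a :: field mat \<Rightarrow> 'a \<Rightarrow> 'a vec list \<Rightarrow> bool" where
  "solves_jordan_system N l us \<longleftrightarrow>
     (let n = dim_row N; u = (\<lambda>j. (0\<^sub>v n # us) ! j) in
        set us \<subseteq> carrier_vec n \<and>
        (\<forall>j < length us. (N - l \<cdot>\<^sub>m 1\<^sub>m n) *\<^sub>v u (j + 1) = u j))"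

text \<open>
  The length of a Jordan chain is the largest \<open>k\<close> for which the system is solvable with the given
  first vector; the maximum is over all solutions with that first vector, not only over those that
  extend \<open>us\<close>.
\<close>

definition jordan_chain :: "'a :: field mat \<Rightarrow> 'a \<Rightarrow> 'a vec list \<Rightarrow> bool" where
  "jordan_chain N l us \<longleftrightarrow>
     square_mat N \<and> us \<noteq> [] \<and> eigenvector N (hd us) l \<and>
     solves_jordan_system N l us \<and>
     (\<forall>ws. ws \<noteq> [] \<and> hd ws = hd us \<and> solves_jordan_system N l ws \<longrightarrow> length ws \<le> length us)"

definition G :: "nat set set" where
  "G = {{1,2}, {1,3}, {2,3}, {2,4}, {3,4}, {4,5}, {4,6}, {4,7}, {5,6}, {5,7}, {3,6}, {3,7}}"

lemma simple_graph_G: "simple_graph 7 G"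
  by (simp add: simple_graph_def G_def)

end

theory Submission
  imports Defs
begin

text \<open>
  The two equations \<open>K v = \<lambda> v\<close> and \<open>K u = \<lambda> u + v\<close> are a finite calculation in the field
  \<open>\<rat>(\<lambda>)\<close>, where \<open>\<lambda>\<^sup>2 + \<lambda> + 2 = 0\<close>. What remains is maximality: no chain of length three starts
  at \<open>v\<close>, whatever its second vector is.

  This follows from a symmetry of \<open>K(G)\<close>, valid for every graph. With \<open>J = diag (I, I - D)\<close> the
  product \<open>J K(G)\<close> is the symmetric matrix with blocks \<open>A\<close>, \<open>D - I\<close>, \<open>D - I\<close>, \<open>0\<close>, so \<open>K(G)\<close>, and
  with it \<open>N = K(G) - \<lambda> I\<close>, is self-adjoint for the bilinear form \<open>B(x, y) = x \<bullet> J y\<close>. If \<open>w\<close> were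
  the third vector of a chain starting at \<open>v\<close>, then \<open>v = N (N w)\<close> and hence
  \<open>B(u, v) = B(N (N u), w) = B(0, w) = 0\<close>. For the given vectors, however,
  \<open>B(u, v) = - (35 + 49 \<lambda>) / 4\<close>, which is not zero because \<open>\<lambda>\<close> is not real.
\<close>

section \<open>Jordan chains of length two of a self-adjoint matrix\<close>

lemma bilinear_form_self_adjoint:
  fixes N S :: "'a::comm_ring_1 mat"
  assumes N: "N \<in> carrier_mat n n" and S: "S \<in> carrier_mat n n"
    and sym: "S * N = N\<^sup>T * S"
    and x: "x \<in> carrier_vec n" and y: "y \<in> carrier_vec n"
  shows "x \<bullet> (S *\<^sub>v (N *\<^sub>v y)) = (N *\<^sub>v x) \<bullet> (S *\<^sub>v y)"
proof -
  have Sy: "S *\<^sub>v y \<in> carrier_vec n"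
    using S y by simp
  have "S *\<^sub>v (N *\<^sub>v y) = (S * N) *\<^sub>v y"
    using N S y by (simp add: assoc_mult_mat_vec)
  also have "\<dots> = N\<^sup>T *\<^sub>v (S *\<^sub>v y)"
    unfolding sym by (rule assoc_mult_mat_vec) (use N S y in auto)
  finally have "x \<bullet> (S *\<^sub>v (N *\<^sub>v y)) = x \<bullet> (N\<^sup>T *\<^sub>v (S *\<^sub>v y))"
    by simp
  also have "\<dots> = (N\<^sup>T *\<^sub>v (S *\<^sub>v y)) \<bullet> x"
    by (rule comm_scalar_prod[of _ n]) (use N Sy x in auto)
  also have "\<dots> = (S *\<^sub>v y) \<bullet> (N *\<^sub>v x)"
    by (rule transpose_vec_mult_scalar[OF N x Sy])
  also have "\<dots> = (N *\<^sub>v x) \<bullet> (S *\<^sub>v y)"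
    by (rule comm_scalar_prod[of _ n]) (use N Sy x in auto)
  finally show ?thesis .
qed

lemma symmetrizer_shift:
  fixes N S :: "'a::comm_ring_1 mat"
  assumes N: "N \<in> carrier_mat n n" and S: "S \<in> carrier_mat n n"
    and sym: "S * N = N\<^sup>T * S"
  shows "S * (N - l \<cdot>\<^sub>m 1\<^sub>m n) = (N - l \<cdot>\<^sub>m 1\<^sub>m n)\<^sup>T * S"
proof -
  have l: "l \<cdot>\<^sub>m 1\<^sub>m n \<in> carrier_mat n n" and Nt: "N\<^sup>T \<in> carrier_mat n n"
    using N by auto
  have t: "(N - l \<cdot>\<^sub>m 1\<^sub>m n)\<^sup>T = N\<^sup>T - l \<cdot>\<^sub>m 1\<^sub>m n"
    using N by (intro eq_matI) auto
  have "S * (l \<cdot>\<^sub>m 1\<^sub>m n) = (l \<cdot>\<^sub>m 1\<^sub>m n) * S"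
    using S by (simp add: mult_smult_distrib[OF S one_carrier_mat] mult_smult_assoc_mat[OF one_carrier_mat S])
  then show ?thesis
    unfolding t by (simp add: mult_minus_distrib_mat[OF S N l] minus_mult_distrib_mat[OF Nt l S] sym)
qed

text \<open>
  A third chain vector \<open>w\<close> would make \<open>v\<close> the image of \<open>w\<close> under the square of the shifted
  matrix; moving both factors to the other side of the form annihilates \<open>u\<close>. The condition on the
  form concerns \<open>v\<close> and \<open>u\<close> only and so excludes the chains whose second vector differs from \<open>u\<close> as
  well. It also forces \<open>v\<close> to be nonzero.
\<close>
lemma jordan_chain_of_length_two:
  fixes N S :: "'a::field mat"
  assumes N: "N \<in> carrier_mat n n" and S: "S \<in> carrier_mat n n"
    and sym: "S * N = N\<^sup>T * S"
    and v: "v \<in> carrier_vec n" and u: "u \<in> carrier_vec n"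
    and Nv: "N *\<^sub>v v = l \<cdot>\<^sub>v v" and Nu: "N *\<^sub>v u = l \<cdot>\<^sub>v u + v"
    and form: "u \<bullet> (S *\<^sub>v v) \<noteq> 0"
  shows "jordan_chain N l [v, u]"
proof -
  define M where "M = N - l \<cdot>\<^sub>m 1\<^sub>m n"
  have M: "M \<in> carrier_mat n n"
    unfolding M_def using N by auto
  have M_mult: "M *\<^sub>v x = N *\<^sub>v x - l \<cdot>\<^sub>v x" if "x \<in> carrier_vec n" for x
  proof -
    have "M *\<^sub>v x = N *\<^sub>v x - (l \<cdot>\<^sub>m 1\<^sub>m n) *\<^sub>v x"
      unfolding M_def by (rule minus_mult_distrib_mat_vec) (use N that in auto)
    also have "(l \<cdot>\<^sub>m 1\<^sub>m n) *\<^sub>v x = l \<cdot>\<^sub>v x"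
      using that by (intro eq_vecI) auto
    finally show ?thesis .
  qed
  have Mv: "M *\<^sub>v v = 0\<^sub>v n"
    unfolding M_mult[OF v] Nv using v by auto
  have Mu: "M *\<^sub>v u = v"
    unfolding M_mult[OF u] Nu using v u by (intro eq_vecI) auto
  have adj: "x \<bullet> (S *\<^sub>v (M *\<^sub>v y)) = (M *\<^sub>v x) \<bullet> (S *\<^sub>v y)"
    if "x \<in> carrier_vec n" "y \<in> carrier_vec n" for x y
    using symmetrizer_shift[OF N S sym, of l] that unfolding M_def[symmetric]
    by (intro bilinear_form_self_adjoint[OF M S]) auto
  have v0: "v \<noteq> 0\<^sub>v n"
  proof
    assume "v = 0\<^sub>v n"
    then have "S *\<^sub>v v = 0\<^sub>v n"
      using S by (intro eq_vecI) auto
    then show False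
      using form u by simp
  qed
  have solves: "solves_jordan_system N l [v, u]"
    using N v u Mv Mu unfolding M_def
    by (auto simp: solves_jordan_system_def Let_def less_Suc_eq)
  have "length ws \<le> 2"
    if ws: "ws \<noteq> []" "hd ws = v" "solves_jordan_system N l ws" for ws
  proof (rule ccontr)
    assume len: "\<not> length ws \<le> 2"
    obtain w2 w rest where ws_eq: "ws = v # w2 # w # rest"
    proof (cases ws)
      case Nil
      then show ?thesis using ws by simp
    next
      case (Cons a ws')
      then show ?thesis
        using that len ws by (cases ws'; cases "tl ws'") auto
    qed
    have sys: "M *\<^sub>v ((0\<^sub>v n # ws) ! (j + 1)) = (0\<^sub>v n # ws) ! j" if "j < length ws" for j
      using ws(3) N that unfolding solves_jordan_system_def M_def Let_def ws_eq by auto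
    have "w2 \<in> carrier_vec n" "w \<in> carrier_vec n"
      using ws(3) N unfolding solves_jordan_system_def Let_def ws_eq by auto
    moreover have "M *\<^sub>v w2 = v" "M *\<^sub>v w = w2"
      using sys[of 1] sys[of 2] unfolding ws_eq by (simp_all add: eval_nat_numeral)
    \<comment> \<open>self-adjointness twice: from \<open>v = M w2\<close> to \<open>B(v, w2)\<close>, then with \<open>w2 = M w\<close>\<close>
    ultimately have "u \<bullet> (S *\<^sub>v v) = (M *\<^sub>v (M *\<^sub>v u)) \<bullet> (S *\<^sub>v w)"
      using adj[of u w2] adj[of v w] u v Mu by simp
    also have "\<dots> = 0"
      using Mu Mv S \<open>w \<in> carrier_vec n\<close> by simp
    finally show False
      using form by contradiction
  qed
  then show ?thesis
    unfolding jordan_chain_def eigenvector_def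
    using N v v0 Nv solves by (auto simp: numeral_2_eq_2)
qed

section \<open>The symmetry of \<open>K(G)\<close>\<close>

definition K_symmetrizer :: "nat \<Rightarrow> nat set set \<Rightarrow> complex mat" where
  "K_symmetrizer n E = four_block_mat (1\<^sub>m n) (0\<^sub>m n n) (0\<^sub>m n n) (1\<^sub>m n - degree_mat n E)"

lemma adjacency_mat_carrier [simp]: "adjacency_mat n E \<in> carrier_mat n n"
  by (simp add: adjacency_mat_def)

lemma degree_mat_carrier [simp]: "degree_mat n E \<in> carrier_mat n n"
  by (simp add: degree_mat_def)

lemma degree_minus_one_carrier [simp]: "degree_mat n E - 1\<^sub>m n \<in> carrier_mat n n"
  by (rule minus_carrier_mat) simp

lemma one_minus_degree_carrier [simp]: "1\<^sub>m n - degree_mat n E \<in> carrier_mat n n"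
  by (rule minus_carrier_mat) simp

lemma K_mat_carrier: "K_mat n E \<in> carrier_mat (n + n) (n + n)"
  unfolding K_mat_def by (rule four_block_carrier_mat) simp_all

lemma K_symmetrizer_carrier: "K_symmetrizer n E \<in> carrier_mat (n + n) (n + n)"
  unfolding K_symmetrizer_def by (rule four_block_carrier_mat) simp_all

text \<open>Both sides equal the symmetric matrix with blocks \<open>A\<close>, \<open>D - I\<close>, \<open>D - I\<close>, \<open>0\<close>.\<close>
lemma K_mat_symmetrizable:
  "K_symmetrizer n E * K_mat n E = (K_mat n E)\<^sup>T * K_symmetrizer n E"
proof -
  let ?A = "adjacency_mat n E" and ?D = "degree_mat n E" and ?I = "1\<^sub>m n :: complex mat"
  let ?O = "0\<^sub>m n n :: complex mat"
  let ?F = "?I - ?D" and ?F' = "?D - ?I"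
  have carr: "?A \<in> carrier_mat n n" "?F \<in> carrier_mat n n" "?F' \<in> carrier_mat n n"
    "- ?I \<in> carrier_mat n n" "?I \<in> carrier_mat n n" "?O \<in> carrier_mat n n"
    by simp_all
  have At: "?A\<^sup>T = ?A"
    by (rule eq_matI) (simp_all add: adjacency_mat_def insert_commute)
  have Ft: "?F'\<^sup>T = ?F'"
    by (rule eq_matI) (simp_all add: degree_mat_def)
  have It: "(- ?I)\<^sup>T = - ?I"
    by (rule eq_matI) simp_all
  have neg: "- ?F = ?F'"
    by (rule eq_matI) (simp_all add: degree_mat_def)
  have dims: "dim_row ?D = n" "dim_col ?D = n"
    by (simp_all add: degree_mat_def)
  have FI: "?F * - ?I = ?F'"
    using neg dims right_mult_one_mat[OF carr(2)] by (subst uminus_mult_right_mat) auto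
  have IF: "- ?I * ?F = ?F'"
    using neg dims left_mult_one_mat[OF carr(2)] by (subst uminus_mult_left_mat) auto
  note products = FI IF left_mult_one_mat[OF carr(1)] right_mult_one_mat[OF carr(1)]
    left_mult_one_mat[OF carr(3)] right_mult_one_mat[OF carr(3)]
    left_mult_zero_mat[OF carr(1)] right_mult_zero_mat[OF carr(1)]
    left_mult_zero_mat[OF carr(2)] right_mult_zero_mat[OF carr(2)]
    left_mult_zero_mat[OF carr(3)] right_mult_zero_mat[OF carr(3)]
    left_mult_zero_mat[OF carr(4)] right_mult_zero_mat[OF carr(4)]
    left_mult_zero_mat[OF carr(6)] right_mult_zero_mat[OF carr(5)]
    left_mult_zero_mat[OF carr(5)]
    left_add_zero_mat[OF carr(1)] right_add_zero_mat[OF carr(1)]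
    left_add_zero_mat[OF carr(3)] right_add_zero_mat[OF carr(3)] left_add_zero_mat[OF carr(6)]
  have "K_symmetrizer n E * K_mat n E = four_block_mat ?A ?F' ?F' ?O"
    unfolding K_symmetrizer_def K_mat_def
      mult_four_block_mat[OF carr(5,6,6,2) carr(1,3,4,6)] products ..
  also have "\<dots> = (K_mat n E)\<^sup>T * K_symmetrizer n E"
    unfolding K_symmetrizer_def K_mat_def
      transpose_four_block_mat[OF carr(1,3,4,6)] At Ft It zero_transpose_mat
      mult_four_block_mat[OF carr(1,4,3,6) carr(5,6,6,2)] products ..
  finally show ?thesis .
qed

lemma adjacency_mat_mult_index:
  assumes "x \<in> carrier_vec n" "i < n"
  shows "(adjacency_mat n E *\<^sub>v x) $ i = (\<Sum>j = 0..<n. if {i + 1, j + 1} \<in> E then x $ j else 0)"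
  using assms by (auto simp: adjacency_mat_def scalar_prod_def intro!: sum.cong)

lemma degree_minus_one_mult_index:
  assumes "x \<in> carrier_vec n" "i < n"
  shows "((degree_mat n E - 1\<^sub>m n) *\<^sub>v x) $ i = (of_nat (card {e \<in> E. i + 1 \<in> e}) - 1) * x $ i"
proof -
  have "((degree_mat n E - 1\<^sub>m n) *\<^sub>v x) $ i =
      (\<Sum>j = 0..<n. (degree_mat n E - 1\<^sub>m n) $$ (i, j) * x $ j)"
    using assms by (simp add: scalar_prod_def)
  also have "\<dots> = (\<Sum>j = 0..<n. if i = j then (of_nat (card {e \<in> E. i + 1 \<in> e}) - 1) * x $ j else 0)"
    using assms by (intro sum.cong) (auto simp: degree_mat_def)
  finally show ?thesis
    using assms by simp
qed

lemma K_mat_mult_append: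
  assumes x: "x \<in> carrier_vec n" and y: "y \<in> carrier_vec n"
  shows "K_mat n E *\<^sub>v (x @\<^sub>v y) =
    (adjacency_mat n E *\<^sub>v x + (degree_mat n E - 1\<^sub>m n) *\<^sub>v y) @\<^sub>v - x"
proof -
  have "K_mat n E *\<^sub>v (x @\<^sub>v y) =
      (adjacency_mat n E *\<^sub>v x + (degree_mat n E - 1\<^sub>m n) *\<^sub>v y) @\<^sub>v
      (- 1\<^sub>m n *\<^sub>v x + 0\<^sub>m n n *\<^sub>v y)"
    unfolding K_mat_def
    by (rule four_block_mat_mult_vec[of _ n n _ n _ n]) (use x y in simp_all)
  also have "- 1\<^sub>m n *\<^sub>v x + 0\<^sub>m n n *\<^sub>v y = - x"
    using x y by (intro eq_vecI) auto
  finally show ?thesis .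
qed

lemma K_symmetrizer_mult_append:
  assumes x: "x \<in> carrier_vec n" and y: "y \<in> carrier_vec n"
  shows "K_symmetrizer n E *\<^sub>v (x @\<^sub>v y) = x @\<^sub>v - ((degree_mat n E - 1\<^sub>m n) *\<^sub>v y)"
proof -
  have "K_symmetrizer n E *\<^sub>v (x @\<^sub>v y) =
      (1\<^sub>m n *\<^sub>v x + 0\<^sub>m n n *\<^sub>v y) @\<^sub>v (0\<^sub>m n n *\<^sub>v x + (1\<^sub>m n - degree_mat n E) *\<^sub>v y)"
    unfolding K_symmetrizer_def
    by (rule four_block_mat_mult_vec[of _ n n _ n _ n]) (use x y in simp_all)
  also have "1\<^sub>m n *\<^sub>v x + 0\<^sub>m n n *\<^sub>v y = x"
    using x y by (intro eq_vecI) auto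
  also have "0\<^sub>m n n *\<^sub>v x + (1\<^sub>m n - degree_mat n E) *\<^sub>v y = - ((degree_mat n E - 1\<^sub>m n) *\<^sub>v y)"
  proof -
    have "1\<^sub>m n - degree_mat n E = - (degree_mat n E - 1\<^sub>m n)"
      by (rule eq_matI) (auto simp: degree_mat_def)
    moreover have "- (degree_mat n E - 1\<^sub>m n) *\<^sub>v y = - ((degree_mat n E - 1\<^sub>m n) *\<^sub>v y)"
      using y by (intro uminus_mult_mat_vec) simp
    moreover have "0\<^sub>m n n *\<^sub>v x = 0\<^sub>v n"
      using x by (intro eq_vecI) auto
    moreover have "- ((degree_mat n E - 1\<^sub>m n) *\<^sub>v y) \<in> carrier_vec n"
      by (intro carrier_vecI) simp
    ultimately show ?thesis
      by simp
  qed
  finally show ?thesis .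
qed

section \<open>The graph on seven vertices\<close>

lemma less_7_cases:
  fixes i :: nat
  assumes "i < 7"
  shows "i = 0 \<or> i = 1 \<or> i = 2 \<or> i = 3 \<or> i = 4 \<or> i = 5 \<or> i = 6"
  using assms by auto

lemma sum_upto_7: "(\<Sum>i = 0..<7. f i) = f 0 + f 1 + f 2 + f 3 + f 4 + f 5 + f (6::nat)"
  by (simp add: eval_nat_numeral)

text \<open>
  Coordinate vectors stay in list form in what follows, without the simplification of
  \<open>vec_of_list\<close> to \<open>vCons\<close>: the entry at a numeral position is then a list lookup, which
  the simplifier evaluates.
\<close>
lemma uminus_vec_of_list:
  fixes xs :: "'a::group_add list"
  shows "- vec_of_list xs = vec_of_list (map uminus xs)"
  by (rule eq_vecI) (simp_all add: vec_of_list_index del: vec_of_list_map)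

lemma smult_vec_of_list:
  fixes xs :: "'a::comm_ring_1 list"
  shows "c \<cdot>\<^sub>v vec_of_list xs = vec_of_list (map ((*) c) xs)"
  by (rule eq_vecI) (simp_all add: vec_of_list_index del: vec_of_list_map)

lemma plus_vec_of_list:
  fixes xs ys :: "'a::comm_ring_1 list"
  assumes "length xs = length ys"
  shows "vec_of_list xs + vec_of_list ys = vec_of_list (map2 (+) xs ys)"
  using assms by (intro eq_vecI) (simp_all add: vec_of_list_index del: vec_of_list_map)

lemma smult_append_vec:
  fixes x y :: "'a::comm_ring_1 vec"
  shows "c \<cdot>\<^sub>v (x @\<^sub>v y) = (c \<cdot>\<^sub>v x) @\<^sub>v (c \<cdot>\<^sub>v y)"
  by (rule eq_vecI) auto

lemma vec_of_list_7_carrier: "vec_of_list [a1, a2, a3, a4, a5, a6, a7] \<in> carrier_vec 7"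
  by (intro carrier_vecI) simp

lemma adjacency_mat_G_mult:
  "adjacency_mat 7 G *\<^sub>v vec_of_list [a1, a2, a3, a4, a5, a6, a7] =
   vec_of_list [a2 + a3, a1 + a3 + a4, a1 + a2 + a4 + a6 + a7, a2 + a3 + a5 + a6 + a7,
     a4 + a6 + a7, a3 + a4 + a5, a3 + a4 + a5]"
  (is "_ *\<^sub>v ?a = ?b")
proof (rule eq_vecI)
  fix i assume "i < dim_vec ?b"
  then have i: "i < 7" by simp
  have "(adjacency_mat 7 G *\<^sub>v ?a) $ i = (\<Sum>j = 0..<7. if {i + 1, j + 1} \<in> G then ?a $ j else 0)"
    by (rule adjacency_mat_mult_index[OF vec_of_list_7_carrier i])
  also have "\<dots> = ?b $ i"
    using less_7_cases[OF i] unfolding sum_upto_7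
    by (elim disjE) (simp_all add: G_def doubleton_eq_iff vec_of_list_index del: vec_of_list_Cons)
  finally show "(adjacency_mat 7 G *\<^sub>v ?a) $ i = ?b $ i" .
qed (simp add: adjacency_mat_def)

lemma degree_G:
  assumes "i < 7"
  shows "card {e \<in> G. i + 1 \<in> e} = [2, 3, 5, 5, 3, 3, 3] ! i"
proof -
  have "finite G" by (simp add: G_def)
  then have "card {e \<in> G. i + 1 \<in> e} = (\<Sum>e\<in>G. if i + 1 \<in> e then 1 else 0)"
    by (simp add: sum.If_cases Int_def)
  also have "\<dots> = [2, 3, 5, 5, 3, 3, 3] ! i"
    using less_7_cases[OF assms]
    by (elim disjE) (simp_all add: G_def doubleton_eq_iff)
  finally show ?thesis .
qed

lemma degree_minus_one_G_mult:
  "(degree_mat 7 G - 1\<^sub>m 7) *\<^sub>v vec_of_list [b1, b2, b3, b4, b5, b6, b7] =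
   vec_of_list [b1, 2 * b2, 4 * b3, 4 * b4, 2 * b5, 2 * b6, 2 * b7]"
  (is "_ *\<^sub>v ?b = ?c")
proof (rule eq_vecI)
  fix i assume "i < dim_vec ?c"
  then have i: "i < 7" by simp
  have "((degree_mat 7 G - 1\<^sub>m 7) *\<^sub>v ?b) $ i = (of_nat ([2, 3, 5, 5, 3, 3, 3] ! i) - 1) * ?b $ i"
    unfolding degree_minus_one_mult_index[OF vec_of_list_7_carrier i] degree_G[OF i] ..
  also have "\<dots> = ?c $ i"
    using less_7_cases[OF i] by (elim disjE) (simp_all add: vec_of_list_index del: vec_of_list_Cons)
  finally show "((degree_mat 7 G - 1\<^sub>m 7) *\<^sub>v ?b) $ i = ?c $ i" .
qed (simp add: degree_mat_def)

lemma K_mat_G_mult: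
  "K_mat 7 G *\<^sub>v (vec_of_list [a1, a2, a3, a4, a5, a6, a7] @\<^sub>v vec_of_list [b1, b2, b3, b4, b5, b6, b7]) =
   vec_of_list [a2 + a3 + b1, a1 + a3 + a4 + 2 * b2, a1 + a2 + a4 + a6 + a7 + 4 * b3,
     a2 + a3 + a5 + a6 + a7 + 4 * b4, a4 + a6 + a7 + 2 * b5, a3 + a4 + a5 + 2 * b6,
     a3 + a4 + a5 + 2 * b7]
   @\<^sub>v vec_of_list [- a1, - a2, - a3, - a4, - a5, - a6, - a7]"
  unfolding K_mat_mult_append[OF vec_of_list_7_carrier vec_of_list_7_carrier]
    adjacency_mat_G_mult degree_minus_one_G_mult uminus_vec_of_list
  by (subst plus_vec_of_list) (simp_all del: vec_of_list_Cons vec_of_list_map)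

lemma K_symmetrizer_G_mult:
  "K_symmetrizer 7 G *\<^sub>v
     (vec_of_list [a1, a2, a3, a4, a5, a6, a7] @\<^sub>v vec_of_list [b1, b2, b3, b4, b5, b6, b7]) =
   vec_of_list [a1, a2, a3, a4, a5, a6, a7] @\<^sub>v
   vec_of_list [- b1, - (2 * b2), - (4 * b3), - (4 * b4), - (2 * b5), - (2 * b6), - (2 * b7)]"
  unfolding K_symmetrizer_mult_append[OF vec_of_list_7_carrier vec_of_list_7_carrier]
    degree_minus_one_G_mult uminus_vec_of_list
  by (simp del: vec_of_list_Cons)

section \<open>The Jordan chain\<close>

definition chain_v :: "complex \<Rightarrow> complex vec" where
  "chain_v l = vec_of_list [l, 2 / l, 0, 1, - 1, 0, 0] @\<^sub>v
     vec_of_list [- 1, - 2 / l ^ 2, 0, - 1 / l, 1 / l, 0, 0]"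

definition chain_u :: "complex \<Rightarrow> complex vec" where
  "chain_u l =
     vec_of_list [1, (5 * l - 3) / 2, (3 - l) / 2, - 7 * (l + 1) / 2, 4 * l + 2, 0, 0] @\<^sub>v
     vec_of_list [0, - (l + 5) / 2, (3 * l + 5) / 4, 3 * (1 - l) / 2, (3 * l - 11) / 4, 0, 0]"

lemma chain_v_carrier: "chain_v l \<in> carrier_vec (7 + 7)"
  unfolding chain_v_def by (intro append_carrier_vec vec_of_list_7_carrier)

lemma chain_u_carrier: "chain_u l \<in> carrier_vec (7 + 7)"
  unfolding chain_u_def by (intro append_carrier_vec vec_of_list_7_carrier)

text \<open>
  The minimal polynomial of \<open>\<lambda>\<close> turns division by \<open>\<lambda>\<close> into a linear expression; then every
  entry of the chain lies in the span of \<open>1\<close> and \<open>\<lambda>\<close> over the rationals.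
\<close>
lemma chain_v_linear:
  assumes l: "l * l = - l - 2"
  shows "chain_v l = vec_of_list [l, - l - 1, 0, 1, - 1, 0, 0] @\<^sub>v
     vec_of_list [- 1, (1 - l) / 2, 0, (l + 1) / 2, - (l + 1) / 2, 0, 0]"
proof -
  have "l \<noteq> 0" using l by auto
  then have inv: "1 / l = - (l + 1) / 2"
    using l by (simp add: field_simps)
  have 1: "2 / l = - l - 1"
    using l \<open>l \<noteq> 0\<close> by (simp add: divide_eq_eq left_diff_distrib)
  have "(1 - l) * l ^ 2 = (1 - l) * (- l - 2)"
    using l by (simp add: power2_eq_square)
  also have "\<dots> = l * l + l - 2"
    by (simp add: algebra_simps)
  also have "\<dots> = - 4"
    using l by simp
  finally have 2: "- 2 / l ^ 2 = (1 - l) / 2"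
    using \<open>l \<noteq> 0\<close> by (subst frac_eq_eq) simp_all
  have 3: "- 1 / l = (l + 1) / 2"
    using l \<open>l \<noteq> 0\<close> by (subst frac_eq_eq) (simp_all add: distrib_right)
  show ?thesis
    unfolding chain_v_def 1 2 3 inv ..
qed

text \<open>
  As rewrite rules, the quadratic equation for \<open>\<lambda>\<close> and this form of it, which reaches a square
  standing in front of a further factor, reduce polynomials in \<open>\<lambda>\<close> to their linear normal form.
\<close>
lemma power_reduction:
  fixes l :: complex
  assumes "l * l = - l - 2"
  shows "l * (l * c) = - (l * c) - 2 * c"
  using assms by (simp add: left_diff_distrib flip: mult.assoc)

lemma K_mat_G_chain_v:
  assumes l: "l * l = - l - 2"
  shows "K_mat 7 G *\<^sub>v chain_v l = l \<cdot>\<^sub>v chain_v l"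
  unfolding chain_v_linear[OF l] K_mat_G_mult smult_append_vec smult_vec_of_list
  by (simp add: field_simps l power_reduction[OF l])

lemma K_mat_G_chain_u:
  assumes l: "l * l = - l - 2"
  shows "K_mat 7 G *\<^sub>v chain_u l = l \<cdot>\<^sub>v chain_u l + chain_v l"
  unfolding chain_u_def chain_v_linear[OF l] K_mat_G_mult smult_append_vec smult_vec_of_list list.map
    append_vec_add[OF vec_of_list_7_carrier vec_of_list_7_carrier
      vec_of_list_7_carrier vec_of_list_7_carrier]
  by (subst plus_vec_of_list, simp, subst plus_vec_of_list, simp,
      simp add: field_simps l power_reduction[OF l])

text \<open>The number that rules out a third chain vector.\<close>
lemma form_chain_u_chain_v:
  assumes l: "l * l = - l - 2"
  shows "chain_u l \<bullet> (K_symmetrizer 7 G *\<^sub>v chain_v l) = - (35 + 49 * l) / 4"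
  unfolding chain_u_def chain_v_linear[OF l] K_symmetrizer_G_mult
  by (simp add: field_simps l power_reduction[OF l])

theorem proposition4p6:
  fixes n' :: nat
  assumes "n' = 7"
  shows "\<exists>(l::complex) (v::complex vec) (u::complex vec).
    jordan_chain (K_mat n' G) l [v, u] \<and>
    l = (- 1 - complex_of_real (sqrt 7) * \<i>) / 2 \<and>
    v \<in> carrier_vec 14 \<and> u \<in> carrier_vec 14 \<and>
    (\<forall>j\<in>{1..7}.
      v $ (j - 1) =
        (if j = 1 then l
         else if j = 2 then 2 / l
         else if j = 3 then 0
         else if j = 4 then 1
         else if j = 5 then - 1
         else 0) \<and>
      v $ (n' + j - 1) =
        (if j = 1 then - 1
         else if j = 2 then - 2 / l ^ 2
         else if j = 3 then 0
         else if j = 4 then - 1 / l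
         else if j = 5 then 1 / l
         else 0) \<and>
      u $ (j - 1) =
        (if j = 1 then 1
         else if j = 2 then (5 * l - 3) / 2
         else if j = 3 then (3 - l) / 2
         else if j = 4 then - 7 * (l + 1) / 2
         else if j = 5 then 4 * l + 2
         else 0) \<and>
      u $ (n' + j - 1) =
        (if j = 1 then 0
         else if j = 2 then - (l + 5) / 2
         else if j = 3 then (3 * l + 5) / 4
         else if j = 4 then 3 * (1 - l) / 2
         else if j = 5 then (3 * l - 11) / 4
         else 0))"
proof -
  define l :: complex where "l = (- 1 - complex_of_real (sqrt 7) * \<i>) / 2"
  have "complex_of_real (sqrt 7) * complex_of_real (sqrt 7) = 7"
    by (simp flip: of_real_mult)
  then have l: "l * l = - l - 2"
    by (simp add: complex_eq_iff l_def field_simps)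
  \<comment> \<open>\<open>l\<close> is not real, so the value of the form at the chain vectors is not zero\<close>
  have "Im (- (35 + 49 * l) / 4) \<noteq> 0"
    by (simp add: l_def)
  then have "- (35 + 49 * l) / 4 \<noteq> 0"
    by (metis zero_complex.simps(2))
  then have "chain_u l \<bullet> (K_symmetrizer 7 G *\<^sub>v chain_v l) \<noteq> 0"
    unfolding form_chain_u_chain_v[OF l] .
  then have chain: "jordan_chain (K_mat n' G) l [chain_v l, chain_u l]"
    unfolding assms
    by (intro jordan_chain_of_length_two[OF K_mat_carrier K_symmetrizer_carrier
          K_mat_symmetrizable chain_v_carrier chain_u_carrier]
        K_mat_G_chain_v[OF l] K_mat_G_chain_u[OF l])
  have carr: "chain_v l \<in> carrier_vec 14" "chain_u l \<in> carrier_vec 14"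
    using chain_v_carrier[of l] chain_u_carrier[of l] by simp_all
  have vertices: "{1..7} = {1, 2, 3, 4, 5, 6, 7 :: nat}"
    by auto
  show ?thesis
  proof (intro exI[of _ l], rule exI[of _ "chain_v l"], rule exI[of _ "chain_u l"], intro conjI)
    show "jordan_chain (K_mat n' G) l [chain_v l, chain_u l]"
      by (rule chain)
    show "l = (- 1 - complex_of_real (sqrt 7) * \<i>) / 2"
      by (rule l_def)
  qed (use carr in \<open>unfold vertices, simp_all add: assms chain_v_def chain_u_def vec_of_list_index
      del: vec_of_list_Cons\<close>)
qed

end
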